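(* Let $X=[0,1]$ with Lebesgue measure $\mu$. Consider the following partial isomorphisms of $X$, where $n$ ranges over $\mathbb N=\{0,1,2,\dots\}$: $$\varphi_1:(0,\tfrac12)\to(\tfrac12,1),\ \varphi_1(x)=x+\tfrac12;\qquad \varphi_2:(\tfrac12,1)\to(\tfrac12,1),\ \varphi_2(x)=x;$$ $$\psi_n^1:\left(\tfrac1{2^{n+1}},\tfrac3{2^{n+2}}\right)\to\left(\tfrac1{2^{n+2}},\tfrac1{2^{n+1}}\right),\ \psi_n^1(x)=x-\tfrac1{2^{n+2}};$$ $$\psi_n^2:\left(\tfrac3{2^{n+2}},\tfrac1{2^{n}}\right)\to\left(\tfrac1{2^{n+2}},\tfrac1{2^{n+1}}\right),\ \psi_n^2(x)=x-\tfrac1{2^{n+1}}.$$ Let $E$ be a countable measure-preserving Borel equivalence relation on $X$ containing the graphs of all these maps. Then $\Phi=\{\varphi_1,\varphi_2\}\cup\{\psi_n^1,\psi_n^2:n\in\mathbb N\}$ is a doubly stochastic element of multiplicity $2$ which is not decomposable. (For each $i=1,2$ the maps $\psi_n^i$, $n\in\mathbb N$, can be glued to one map onto $(0,\frac12)$.) In particular, there exists a doubly stochastic element of multiplicity $2$ that is not decomposable.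
   Context: All equalities of sets and functions are modulo null sets. For a countable measure-preserving Borel equivalence relation $E$ on a standard probability space $(X,\mu)$: $[E]$ is the set of measurable bijections $\theta:X\to X$ with $\mathrm{graph}(\theta)\subset E$; $[[E]]$ is the set of measurable bijections $\varphi:A\to B$ between measurable subsets $A,B\subset X$ with $\mathrm{graph}(\varphi)=\{(x,\varphi(x)):x\in A\}\subset E$. A doubly stochastic element (DSE) of multiplicity $n\geq1$ is a finite or countable family $\Phi=\{\varphi_i:A_i\to B_i\}_i$ of elements of $[[E]]$ with $\sum_i\chi_{A_i}=n$ and $\sum_i\chi_{B_i}=n$ almost everywhere. Its associated matrix is $M(\Phi)=\sum_i\chi_{\mathrm{graph}(\varphi_i)}:E\to\mathbb N$. A DSE $\Phi$ of multiplicity $n$ is decomposable if there exist $\theta_1,\dots,\theta_n\in[E]$ with $\sum_{j=1}^n\chi_{\mathrm{graph}(\theta_j)}=M(\Phi)$ (almost everywhere with respect to the counting measure $\nu(C)=\int_X\mathrm{Card}(C\cap(\{x\}\times X))\,d\mu(x)$ on $E$). *)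

theory Defs
  imports "HOL-Analysis.Analysis"
begin

text \<open>A partially defined map \<open>\<phi> : A \<rightarrow> B\<close>; the values of \<open>pfun\<close> outside \<open>pdom\<close> are irrelevant.\<close>

record 'a pmap =
  pdom :: "'a set"
  pcod :: "'a set"
  pfun :: "'a \<Rightarrow> 'a"

definition pgraph :: "'a pmap \<Rightarrow> ('a \<times> 'a) set" where
  "pgraph \<phi> = {(x, pfun \<phi> x) | x. x \<in> pdom \<phi>}"

text \<open>The full pseudogroup \<open>[[E]]\<close>. Elements are honest (everywhere defined) bijections between
  measurable sets.\<close>

definition full_pseudogroup :: "'a measure \<Rightarrow> ('a \<times> 'a) set \<Rightarrow> 'a pmap set" where
  "full_pseudogroup M E = {\<phi>.
     pdom \<phi> \<in> sets M \<and> pcod \<phi> \<in> sets M \<and>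
     pfun \<phi> \<in> measurable (restrict_space M (pdom \<phi>)) (restrict_space M (pcod \<phi>)) \<and>
     bij_betw (pfun \<phi>) (pdom \<phi>) (pcod \<phi>) \<and>
     pgraph \<phi> \<subseteq> E}"

text \<open>The full group \<open>[E]\<close> of measurable bijections \<open>X \<rightarrow> X\<close>. Since equalities of sets are modulo
  null sets, the domain and the range are only required to be conull.\<close>

definition full_group :: "'a measure \<Rightarrow> ('a \<times> 'a) set \<Rightarrow> 'a pmap set" where
  "full_group M E = {\<theta> \<in> full_pseudogroup M E.
     (AE x in M. x \<in> pdom \<theta>) \<and> (AE x in M. x \<in> pcod \<theta>)}"

definition preserves_measure :: "'a measure \<Rightarrow> 'a pmap \<Rightarrow> bool" where
  "preserves_measure M \<phi> \<longleftrightarrow>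
     (\<forall>C\<in>sets M. C \<subseteq> pcod \<phi> \<longrightarrow> emeasure M (pfun \<phi> -` C \<inter> pdom \<phi>) = emeasure M C)"

definition countable_mp_equiv_rel :: "'a measure \<Rightarrow> ('a \<times> 'a) set \<Rightarrow> bool" where
  "countable_mp_equiv_rel M E \<longleftrightarrow>
     equiv (space M) E \<and> E \<in> sets (M \<Otimes>\<^sub>M M) \<and>
     (\<forall>x\<in>space M. countable (E `` {x})) \<and>
     (\<forall>\<phi>\<in>full_pseudogroup M E. preserves_measure M \<phi>)"

text \<open>Families \<open>(\<Phi> i)\<close> are indexed by a set \<open>I\<close>. The sums over \<open>I\<close> are taken in
  \<^typ>\<open>ennreal\<close>, where they always converge.\<close>

definition DSE :: "'a measure \<Rightarrow> ('a \<times> 'a) set \<Rightarrow> nat \<Rightarrow> 'i set \<Rightarrow> ('i \<Rightarrow> 'a pmap) \<Rightarrow> bool" where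
  "DSE M E n I \<Phi> \<longleftrightarrow>
     n \<ge> 1 \<and> countable I \<and> (\<forall>i\<in>I. \<Phi> i \<in> full_pseudogroup M E) \<and>
     (AE x in M. (\<Sum>\<^sub>\<infinity>i\<in>I. indicator (pdom (\<Phi> i)) x :: ennreal) = of_nat n) \<and>
     (AE x in M. (\<Sum>\<^sub>\<infinity>i\<in>I. indicator (pcod (\<Phi> i)) x :: ennreal) = of_nat n)"

definition dse_matrix :: "'i set \<Rightarrow> ('i \<Rightarrow> 'a pmap) \<Rightarrow> 'a \<times> 'a \<Rightarrow> ennreal" where
  "dse_matrix I \<Phi> p = (\<Sum>\<^sub>\<infinity>i\<in>I. indicator (pgraph (\<Phi> i)) p)"

definition counting_nu :: "'a measure \<Rightarrow> ('a \<times> 'a) set \<Rightarrow> ennreal" where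
  "counting_nu M C = (\<integral>\<^sup>+x. emeasure (count_space UNIV) (C \<inter> ({x} \<times> space M)) \<partial>M)"

definition decomposable ::
    "'a measure \<Rightarrow> ('a \<times> 'a) set \<Rightarrow> nat \<Rightarrow> 'i set \<Rightarrow> ('i \<Rightarrow> 'a pmap) \<Rightarrow> bool" where
  "decomposable M E n I \<Phi> \<longleftrightarrow>
     (\<exists>\<theta> :: nat \<Rightarrow> 'a pmap.
        (\<forall>j\<in>{1..n}. \<theta> j \<in> full_group M E) \<and>
        counting_nu M {p \<in> E. (\<Sum>j=1..n. indicator (pgraph (\<theta> j)) p) \<noteq> dse_matrix I \<Phi> p} = 0)"

text \<open>\<open>g\<close> glues the maps \<open>\<psi> n\<close> to one element of \<open>[[E]]\<close> whose range is \<open>B\<close> modulo null sets.\<close>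

definition glues_onto ::
    "'a measure \<Rightarrow> ('a \<times> 'a) set \<Rightarrow> (nat \<Rightarrow> 'a pmap) \<Rightarrow> 'a set \<Rightarrow> 'a pmap \<Rightarrow> bool" where
  "glues_onto M E \<psi> B g \<longleftrightarrow>
     g \<in> full_pseudogroup M E \<and>
     pdom g = (\<Union>n. pdom (\<psi> n)) \<and>
     (\<forall>n. \<forall>x\<in>pdom (\<psi> n). pfun g x = pfun (\<psi> n) x) \<and>
     (AE x in M. x \<in> pcod g \<longleftrightarrow> x \<in> B)"

definition mu01 :: "real measure" where
  "mu01 = restrict_space lborel {0..1}"

definition phi1 :: "real pmap" where
  "phi1 = \<lparr>pdom = {0<..<1/2}, pcod = {1/2<..<1}, pfun = (\<lambda>x. x + 1/2)\<rparr>"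

definition phi2 :: "real pmap" where
  "phi2 = \<lparr>pdom = {1/2<..<1}, pcod = {1/2<..<1}, pfun = (\<lambda>x. x)\<rparr>"

definition psi1 :: "nat \<Rightarrow> real pmap" where
  "psi1 n = \<lparr>pdom = {1/2^(n+1)<..<3/2^(n+2)}, pcod = {1/2^(n+2)<..<1/2^(n+1)},
             pfun = (\<lambda>x. x - 1/2^(n+2))\<rparr>"

definition psi2 :: "nat \<Rightarrow> real pmap" where
  "psi2 n = \<lparr>pdom = {3/2^(n+2)<..<1/2^n}, pcod = {1/2^(n+2)<..<1/2^(n+1)},
             pfun = (\<lambda>x. x - 1/2^(n+1))\<rparr>"

datatype ex_index = Phi1 | Phi2 | Psi1 nat | Psi2 nat

fun ex_family :: "ex_index \<Rightarrow> real pmap" where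
  "ex_family Phi1 = phi1"
| "ex_family Phi2 = phi2"
| "ex_family (Psi1 n) = psi1 n"
| "ex_family (Psi2 n) = psi2 n"

end

(* Suppose the family decomposes as theta_1 + theta_2. At almost every x exactly one phi-map and
   one psi-map are defined, theta_1 follows one of them and theta_2 the other. Let A be the set
   where theta_1 follows the phi-map. Almost every point of (0,1) has two preimages under the
   phi-maps or under the psi-maps; by injectivity of theta_1 and theta_2 exactly one of them lies
   in A. The two phi-preimages differ in the first binary digit, the two psi-preimages in the digit
   after the leading 1. By induction A is exchanged with its complement by flipping any
   digit, so A fills exactly half of every dyadic interval, which no measurable set does.
   Existence: take x ~ y iff x - y is rational. *)
theory Submission
  imports Defs
begin

section \<open>Sets exchanged with their complement by digit flips\<close>

text \<open>The domains pair one phi-map with one psi-map, whereas the codomains pair maps of the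
  same kind. So choosing the phi-map at one point forces the psi-map or the phi-map elsewhere, and a
  single set \<open>A\<close> records all choices. The psi-maps flip only the digit right after the
  leading 1, so digits farther right need transport: translating a dyadic interval to the one at 0
  preserves or negates membership in \<open>A\<close>, with a sign that is constant on the interval.
  A point and its flipped partner carry the same sign, which cancels. Every relation holds only
  almost everywhere, yet many of them are chained. All shifts are rational, so one conull set closed
  under rational translations serves them all. Filling half of every dyadic interval is
  contradictory because it extends to every Borel subset of \<open>{0<..1}\<close>, and
  \<open>A\<close> cannot fill half of itself unless it is null.\<close>

lemma AE_rational_shifts:
  assumes "AE x in lborel. P x"
  shows "AE x :: real in lborel. \<forall>q\<in>\<rat>. P (x + q)"
proof -
  have "AE x in lborel. P (x + q)" for q
  proof -
    obtain N where N: "{x. \<not> P x} \<subseteq> N" "N \<in> null_sets lborel"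
      using assms by (auto simp: eventually_ae_filter)
    have "{x. x - (- q) \<in> N} \<in> null_sets lborel"
      by (rule null_sets_translation) fact
    then show ?thesis
      using N(1) by (intro AE_I') auto
  qed
  then show ?thesis
    by (simp add: AE_ball_countable countable_rat)
qed

text \<open>In binary digits, \<open>flip0\<close> concerns the first digit and \<open>flip\<close> the digit following the
  leading 1. Induction on the level transports a dyadic interval to the one adjacent to 0, where
  \<open>flip\<close> becomes applicable.\<close>

lemma digit_flip:
  fixes P :: "real \<Rightarrow> bool"
  assumes G: "\<And>x q. x \<in> G \<Longrightarrow> q \<in> \<rat> \<Longrightarrow> x + q \<in> G"
    and flip0: "\<And>x. x \<in> G \<Longrightarrow> 0 < x \<Longrightarrow> x < 1/2 \<Longrightarrow> P x \<longleftrightarrow> \<not> P (x + 1/2)"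
    and flip: "\<And>n x. x \<in> G \<Longrightarrow> n \<ge> 1 \<Longrightarrow> 1/2^n < x \<Longrightarrow> x < 1/2^n + 1/2^(n+1) \<Longrightarrow>
                 P x \<longleftrightarrow> \<not> P (x + 1/2^(n+1))"
    and n: "n \<ge> 1" and j: "j < 2^n"
    and x: "x \<in> G" "real j/2^n < x" "x < real j/2^n + 1/2^(n+1)"
  shows "P x \<longleftrightarrow> \<not> P (x + 1/2^(n+1))"
proof -
  \<comment> \<open>\<open>c\<close> is the sign of the translation onto the \<open>j\<close>-th
    dyadic interval of level \<open>n\<close>. It may not depend on \<open>x\<close>: it is applied
    to two points at once and has to cancel.\<close>
  let ?Q = "\<lambda>n j. \<exists>c. \<forall>x\<in>G. 0 < x \<and> x < 1/2^n \<longrightarrow> P (x + real j/2^n) = (c \<noteq> P x)"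
  have base_flip: "P x \<longleftrightarrow> \<not> P (x + 1/2^(n+1))"
    if n: "n \<ge> 1" and Q: "?Q n 1" and x: "x \<in> G" "0 < x" "x < 1/2^(n+1)" for n x
  proof -
    obtain c where c: "\<And>x. x \<in> G \<Longrightarrow> 0 < x \<Longrightarrow> x < 1/2^n \<Longrightarrow> P (x + 1/2^n) = (c \<noteq> P x)"
      using Q unfolding of_nat_1 by blast
    have half: "1/2^(n+1) + 1/2^(n+1) = (1/2^n :: real)" by simp
    have pos: "(0::real) < 1/2^(n+1)" by simp
    \<comment> \<open>Adding \<open>1/2^n\<close> puts a leading 1 directly before the digit to be
      flipped, so \<open>flip\<close> applies; both points are moved back with the same
      \<open>c\<close>.\<close>
    have "P (x + 1/2^n) \<longleftrightarrow> \<not> P (x + 1/2^n + 1/2^(n+1))"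
      using x n by (intro flip G) auto
    moreover have "P (x + 1/2^n) = (c \<noteq> P x)"
      by (rule c) (use x half pos in linarith)+
    moreover have "P (x + 1/2^(n+1) + 1/2^n) = (c \<noteq> P (x + 1/2^(n+1)))"
      by (rule c, rule G) (use x half pos in \<open>simp_all del: power_Suc\<close>)
    moreover have "x + 1/2^n + 1/2^(n+1) = x + 1/2^(n+1) + 1/2^n" by simp
    ultimately show ?thesis by metis
  qed
  have Q: "?Q n j" if "j < 2^n" for j
    using n that
  proof (induction n arbitrary: j rule: dec_induct)
    case base
    then have "j = 0 \<or> j = 1" by auto
    then show ?case
    proof
      assume "j = 0"
      then show ?thesis by (auto intro!: exI[of _ False])
    next
      assume "j = 1"
      then show ?thesis using flip0 by (auto intro!: exI[of _ True])
    qed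
  next
    case (step n)
    \<comment> \<open>\<open>b\<close> is the last binary digit of \<open>j\<close>. A shift by
      \<open>b/2^Suc n\<close> stays inside \<open>(0, 1/2^n)\<close> and has sign
      \<open>b = 1\<close> by \<open>base_flip\<close>; the shift by \<open>i/2^n\<close> that
      follows has the sign of the induction hypothesis.\<close>
    define i b where "i = j div 2" and "b = j mod 2"
    have j: "j = 2 * i + b" "b < 2" by (auto simp: i_def b_def)
    have "i < 2^n" using step.prems by (auto simp: i_def)
    from step.IH[OF this] obtain c
      where c: "\<And>x. x \<in> G \<Longrightarrow> 0 < x \<Longrightarrow> x < 1/2^n \<Longrightarrow> P (x + real i/2^n) = (c \<noteq> P x)"
      by blast
    have "(1::nat) < 2^n" using step.hyps(1) by (intro one_less_power) auto
    with step.IH have Q1: "?Q n 1" by blast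
    have "P (x + real j/2^Suc n) = ((c \<noteq> (b = 1)) \<noteq> P x)" if x: "x \<in> G" "0 < x" "x < 1/2^Suc n" for x
    proof -
      have eq: "x + real j/2^Suc n = x + real b/2^Suc n + real i/2^n"
        by (simp add: j field_simps)
      have b: "real b \<le> 1" using j by auto
      have "x + real b/2^Suc n < 1/2^Suc n + 1/2^Suc n"
        using x b by (intro add_less_le_mono) (auto simp: divide_right_mono)
      then have "P (x + real b/2^Suc n + real i/2^n) = (c \<noteq> P (x + real b/2^Suc n))"
        using x by (intro c G) (auto intro!: add_pos_nonneg)
      moreover have "P (x + real b/2^Suc n) = ((b = 1) \<noteq> P x)"
        using j base_flip[OF step.hyps(1) Q1, of x] x by (cases "b = 0") (auto simp: less_2_cases_iff)
      ultimately show ?thesis unfolding eq by blast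
    qed
    then show ?case by (intro exI[of _ "c \<noteq> (b = 1)"]) auto
  qed
  obtain c where c: "\<And>x. x \<in> G \<Longrightarrow> 0 < x \<Longrightarrow> x < 1/2^n \<Longrightarrow> P (x + real j/2^n) = (c \<noteq> P x)"
    using Q[OF j] by blast
  \<comment> \<open>\<open>y\<close> is \<open>x\<close> with its first \<open>n\<close> digits
    cleared. Both \<open>y\<close> and \<open>y + 1/2^(n+1)\<close> lie in
    \<open>(0, 1/2^n)\<close>, so one \<open>c\<close> serves both.\<close>
  define y where "y = x - real j/2^n"
  have "y \<in> G" using G[OF x(1), of "- (real j/2^n)"] by (simp add: y_def)
  then have y: "y \<in> G" "0 < y" "y < 1/2^(n+1)" using x by (auto simp: y_def)
  have "(1::nat) < 2^n" using n by (intro one_less_power) auto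
  then have "P y \<longleftrightarrow> \<not> P (y + 1/2^(n+1))"
    using base_flip[OF n Q y] by simp
  moreover have half: "1/2^(n+1) + 1/2^(n+1) = (1/2^n :: real)" by simp
  moreover have pos: "(0::real) < 1/2^(n+1)" by simp
  moreover have "P (y + real j/2^n) = (c \<noteq> P y)"
    by (rule c) (use y half pos in linarith)+
  moreover have "P (y + 1/2^(n+1) + real j/2^n) = (c \<noteq> P (y + 1/2^(n+1)))"
    by (rule c, rule G) (use y half pos in \<open>simp_all del: power_Suc\<close>)
  moreover have "y + real j/2^n = x" "y + 1/2^(n+1) + real j/2^n = x + 1/2^(n+1)"
    by (simp_all add: y_def)
  ultimately show ?thesis by metis
qed

section \<open>Borel sets filling half of every dyadic interval\<close>

lemma fmeasurable_Int_Ioc: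
  assumes "A \<in> sets borel"
  shows "A \<inter> {c<..d::real} \<in> fmeasurable lborel"
  by (rule fmeasurableI2[OF fmeasurable_cbox[of c d]]) (use assms in auto)

lemma measure_Int_Ioc_split:
  assumes A: "A \<in> sets borel" and "c \<le> d" "d \<le> (e::real)"
  shows "measure lborel (A \<inter> {c<..e}) = measure lborel (A \<inter> {c<..d}) + measure lborel (A \<inter> {d<..e})"
proof -
  have "A \<inter> {c<..e} = A \<inter> {c<..d} \<union> A \<inter> {d<..e}" using assms by auto
  then show ?thesis
    by (simp only:, intro measure_Un_AE fmeasurable_Int_Ioc A) auto
qed

text \<open>Translated back by \<open>h\<close>, the part of \<open>A\<close> in the upper half
  becomes, up to a null set, the complement of \<open>A\<close> in the lower half; the two parts
  therefore have total length \<open>h\<close>.\<close>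

lemma measure_half_if_flip:
  assumes A[measurable]: "A \<in> sets borel" and h: "h > 0"
    and flip: "AE x in lborel. a < x \<and> x < a + h \<longrightarrow> (x \<in> A \<longleftrightarrow> x + h \<notin> A)"
  shows "measure lborel (A \<inter> {a<..a + 2*h}) = (h :: real)"
proof -
  have "measure lborel (A \<inter> {a + h<..a + 2*h}) = measure lborel ((\<lambda>x. h + x) -` (A \<inter> {a + h<..a + 2*h}))"
    by (subst (1) lborel_distr_plus[of h, symmetric], subst measure_distr) auto
  also have "(\<lambda>x. h + x) -` (A \<inter> {a + h<..a + 2*h}) = {x. a < x \<and> x \<le> a + h \<and> x + h \<in> A}"
    by (auto simp: algebra_simps)
  also have "measure lborel \<dots> = measure lborel ({a<..a + h} - A)"
  proof (rule measure_eq_AE)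
    show "AE x in lborel. x \<in> {x. a < x \<and> x \<le> a + h \<and> x + h \<in> A} \<longleftrightarrow> x \<in> {a<..a + h} - A"
      using flip AE_lborel_singleton[of "a + h"] by eventually_elim auto
  qed auto
  also have "{a<..a + h} - A = {a<..a + h} - A \<inter> {a<..a + h}" by auto
  also have "measure lborel \<dots> = h - measure lborel (A \<inter> {a<..a + h})"
    using h by (subst measure_Diff) auto
  finally show ?thesis
    using measure_Int_Ioc_split[OF A, of a "a + h" "a + 2*h"] h by simp
qed

text \<open>The distribution function of \<open>A\<close> is \<open>t/2\<close> at dyadic points,
  hence everywhere on \<open>{0..1}\<close> by monotonicity. So \<open>A\<close> and the constant
  1/2 are densities of the same measure on \<open>{0<..1}\<close>; evaluated at \<open>A\<close>
  itself this gives 1/2 = 1/4.\<close>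

lemma dyadic_halves_contradiction:
  fixes A :: "real set"
  assumes A[measurable]: "A \<in> sets borel"
    and half: "\<And>n j. n \<ge> 1 \<Longrightarrow> j < 2^n \<Longrightarrow>
      measure lborel (A \<inter> {real j/2^n<..real j/2^n + 2 * (1/2^(n+1))}) = 1/2^(n+1)"
  shows False
proof -
  define F where "F t = measure lborel (A \<inter> {0<..t})" for t
  note fm = fmeasurable_Int_Ioc[OF A]
  have add: "F t = F s + measure lborel (A \<inter> {s<..t})" if "0 \<le> s" "s \<le> t" for s t
    unfolding F_def using that by (rule measure_Int_Ioc_split[OF A])
  have dyadic: "F (real j/2^n) = real j/2^n / 2" if "n \<ge> 1" "j \<le> 2^n" for n j
    using that(2)
  proof (induction j)
    case 0
    then show ?case by (simp add: F_def)
  next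
    case (Suc j)
    have "real (Suc j)/2^n = real j/2^n + 2 * (1/2^(n+1))" by (simp add: field_simps)
    then have "F (real (Suc j)/2^n) = F (real j/2^n) + 1/2^(n+1)"
      using add[of "real j/2^n" "real (Suc j)/2^n"] half[of n j] Suc.prems \<open>n \<ge> 1\<close> by simp
    then show ?case using Suc by (simp add: field_simps)
  qed
  have F: "F t = t/2" if t: "0 \<le> t" "t \<le> 1" for t
  proof -
    have "\<bar>F t - t/2\<bar> \<le> 1/2^n" if n: "n \<ge> 1" for n
    proof -
      \<comment> \<open>\<open>s\<close> is the dyadic point of level \<open>n\<close> just below
        \<open>t\<close>; from \<open>s\<close> to \<open>t\<close> the function \<open>F\<close>
        grows by at most \<open>t - s\<close>.\<close>
      define j where "j = nat \<lfloor>t * 2^n\<rfloor>"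
      have j: "real j \<le> t * 2^n" "t * 2^n < real j + 1"
        using t by (auto simp: j_def)
      define s where "s = real j/2^n"
      have s: "0 \<le> s" "s \<le> t" "t \<le> s + 1/2^n"
        using j by (auto simp: s_def field_simps)
      have "real j \<le> 2^n" using j t by (smt (verit) mult_left_le_one_le zero_le_power)
      then have "j \<le> 2^n" using of_nat_le_iff by fastforce
      then have "F s = s/2" unfolding s_def by (intro dyadic n)
      moreover have "measure lborel (A \<inter> {s<..t}) \<le> measure lborel {s<..t}"
        using fm[of s t] fmeasurable_Int_Ioc[of UNIV s t]
        by (intro measure_mono_fmeasurable) auto
      moreover have "measure lborel {s<..t} = t - s" using s by simp
      ultimately show ?thesis using add[of s t] s measure_nonneg[of lborel "A \<inter> {s<..t}"]
        by linarith
    qed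
    then have ev: "\<forall>\<^sub>F n in sequentially. \<bar>F t - t/2\<bar> \<le> 1/2^n"
      by (auto simp: eventually_sequentially)
    have "(\<lambda>n. 1/2^n :: real) \<longlonglongrightarrow> 0"
      using LIMSEQ_realpow_zero[of "1/2::real"] by (simp add: power_one_over)
    from this ev have "\<bar>F t - t/2\<bar> \<le> 0"
      by (rule tendsto_lowerbound) simp
    then show ?thesis by simp
  qed
  let ?A = "A \<inter> {0<..1}"
  have "density lborel (indicator ?A) = density lborel (\<lambda>x. ennreal (1/2) * indicator {0<..1} x)"
  proof (rule measure_eqI_lessThan)
    fix x :: real
    \<comment> \<open>Both measures live on \<open>{0<..1}\<close>, so the ray above
      \<open>x\<close> only counts from \<open>x\<close> clamped to the unit interval.\<close>
    define y where "y = min 1 (max 0 x)"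
    have y: "0 \<le> y" "y \<le> 1" "{0<..1} \<inter> {x<..} = {y<..1}" by (auto simp: y_def)
    have "emeasure (density lborel (indicator ?A)) {x<..} = emeasure lborel (A \<inter> ({0<..1} \<inter> {x<..}))"
      by (simp add: emeasure_density flip: indicator_inter_arith) (simp add: Int_assoc)
    also have "\<dots> = ennreal ((1 - y)/2)"
      using add[of y 1] y F[of 1] F[of y] fm by (simp add: emeasure_eq_measure2 field_simps)
    finally have 1: "emeasure (density lborel (indicator ?A)) {x<..} = ennreal ((1 - y)/2)" .
    have "emeasure (density lborel (\<lambda>x. ennreal (1/2) * indicator {0<..1} x)) {x<..}
        = ennreal (1/2) * emeasure lborel ({0<..1} \<inter> {x<..})"
      by (simp add: emeasure_density nn_integral_cmult mult.assoc flip: indicator_inter_arith)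
    also have "\<dots> = ennreal ((1 - y)/2)"
      unfolding y(3) emeasure_lborel_Ioc[OF y(2)] using y
      by (subst ennreal_mult[symmetric]) auto
    finally show "emeasure (density lborel (indicator ?A)) {x<..} =
       emeasure (density lborel (\<lambda>x. ennreal (1/2) * indicator {0<..1} x)) {x<..}" using 1 by simp
    show "emeasure (density lborel (indicator ?A)) {x<..} < \<infinity>" using 1 by simp
  qed auto
  then have "emeasure (density lborel (indicator ?A)) ?A
    = emeasure (density lborel (\<lambda>x. ennreal (1/2) * indicator {0<..1} x)) ?A" by simp
  also have "emeasure (density lborel (indicator ?A)) ?A = emeasure lborel ?A"
    by (simp add: emeasure_density flip: indicator_inter_arith)
  also have "emeasure (density lborel (\<lambda>x. ennreal (1/2) * indicator {0<..1} x)) ?A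
     = ennreal (1/2) * emeasure lborel ?A"
    by (simp add: emeasure_density nn_integral_cmult mult.assoc Int_ac flip: indicator_inter_arith)
  finally have "emeasure lborel ?A = ennreal (1/2) * emeasure lborel ?A" .
  moreover have "measure lborel ?A = 1/2" using F[of 1] by (simp add: F_def)
  then have "emeasure lborel ?A = ennreal (1/2)" using fm[of 0 1] by (simp only: emeasure_eq_measure2)
  ultimately have "ennreal (1/2) = ennreal (1/2 * (1/2))"
    by (subst ennreal_mult) auto
  then show False by (subst (asm) ennreal_inj) auto
qed

lemma no_measurable_digit_flip:
  fixes A :: "real set"
  assumes A[measurable]: "A \<in> sets borel"
    and flip0: "AE x in lborel. 0 < x \<and> x < 1/2 \<longrightarrow> (x \<in> A \<longleftrightarrow> x + 1/2 \<notin> A)"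
    and flip: "\<And>n. n \<ge> 1 \<Longrightarrow> AE x in lborel. 1/2^n < x \<and> x < 1/2^n + 1/2^(n+1) \<longrightarrow>
                 (x \<in> A \<longleftrightarrow> x + 1/2^(n+1) \<notin> A)"
  shows False
proof (rule dyadic_halves_contradiction[OF A])
  fix n j :: nat
  assume n: "n \<ge> 1" and j: "j < 2^n"
  define R where "R x \<longleftrightarrow> (0 < x \<and> x < 1/2 \<longrightarrow> (x \<in> A \<longleftrightarrow> x + 1/2 \<notin> A)) \<and>
     (\<forall>n\<ge>1. 1/2^n < x \<and> x < 1/2^n + 1/2^(n+1) \<longrightarrow> (x \<in> A \<longleftrightarrow> x + 1/2^(n+1) \<notin> A))" for x
  have "AE x in lborel. R x"
    unfolding R_def using flip0 flip by (auto simp: AE_all_countable intro!: AE_impI)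
  then have "AE x in lborel. \<forall>q\<in>\<rat>. R (x + q)" by (rule AE_rational_shifts)
  then have "AE x in lborel. real j/2^n < x \<and> x < real j/2^n + 1/2^(n+1) \<longrightarrow>
      (x \<in> A \<longleftrightarrow> x + 1/2^(n+1) \<notin> A)"
  proof eventually_elim
    case (elim x)
    \<comment> \<open>On \<open>G\<close> all flip relations hold without exception and survive
      every rational shift, as the pointwise \<open>digit_flip\<close> demands.\<close>
    define G where "G = {y. \<forall>q\<in>\<rat>. R (y + q)}"
    have G: "y + q \<in> G" if "y \<in> G" "q \<in> \<rat>" for y q
      using that by (auto simp: G_def add.assoc)
    have R: "R y" if "y \<in> G" for y
      using that by (auto simp: G_def dest!: bspec[of _ _ 0])
    have "x \<in> G" using elim by (simp add: G_def)
    have 0: "y \<in> A \<longleftrightarrow> \<not> y + 1/2 \<in> A" if "y \<in> G" "0 < y" "y < 1/2" for y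
      using R[OF that(1)] that(2-) by (simp add: R_def)
    have 1: "y \<in> A \<longleftrightarrow> \<not> y + 1/2^(m+1) \<in> A"
      if "y \<in> G" "m \<ge> 1" "1/2^m < y" "y < 1/2^m + 1/2^(m+1)" for m y
      using R[OF that(1)] that(2-) unfolding R_def by blast
    show ?case
      using digit_flip[where P = "\<lambda>x. x \<in> A" and G = G, OF G 0 1 n j \<open>x \<in> G\<close>] by blast
  qed
  then show "measure lborel (A \<inter> {real j/2^n<..real j/2^n + 2 * (1/2^(n+1))}) = 1/2^(n+1)"
    by (intro measure_half_if_flip) auto
qed

section \<open>The family of multiplicity 2\<close>

lemma space_mu01 [simp]: "space mu01 = {0..1}"
  by (simp add: mu01_def space_restrict_space)

lemma sets_mu01: "S \<in> sets mu01 \<longleftrightarrow> S \<subseteq> {0..1} \<and> S \<in> sets borel"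
  by (simp add: mu01_def sets_restrict_space_iff)

lemma emeasure_mu01: "S \<subseteq> {0..1} \<Longrightarrow> emeasure mu01 S = emeasure lborel S"
  by (simp add: mu01_def emeasure_restrict_space)

lemma AE_mu01_iff: "(AE x in mu01. P x) \<longleftrightarrow> (AE x in lborel. x \<in> {0..1} \<longrightarrow> P x)"
  unfolding mu01_def by (subst AE_restrict_space_iff) auto

lemma AE_irrational: "AE x in lborel. (x :: real) \<notin> \<rat>"
  by (rule AE_not_in, rule countable_imp_null_set_lborel, rule countable_rat)

lemma Rats_in_borel: "\<rat> \<in> sets (borel :: real measure)"
  by (rule sets.countable[OF _ countable_rat]) simp

lemma mem_pgraph_iff: "(x, y) \<in> pgraph \<phi> \<longleftrightarrow> x \<in> pdom \<phi> \<and> y = pfun \<phi> x"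
  by (auto simp: pgraph_def)

text \<open>A total extension turns measurability on a restricted space into plain Borel
  measurability, so sets defined by values of partial maps become Borel. The default 0 is harmless
  as long as membership in \<open>pdom\<close> is required alongside.\<close>

definition ext0 :: "real pmap \<Rightarrow> real \<Rightarrow> real" where
  "ext0 \<phi> x = (if x \<in> pdom \<phi> then pfun \<phi> x else 0)"

lemma full_pseudogroup_mu01_iff:
  "\<phi> \<in> full_pseudogroup mu01 E \<longleftrightarrow>
     pdom \<phi> \<subseteq> {0..1} \<and> pdom \<phi> \<in> sets borel \<and> pcod \<phi> \<subseteq> {0..1} \<and> pcod \<phi> \<in> sets borel \<and>
     ext0 \<phi> \<in> borel_measurable borel \<and> bij_betw (pfun \<phi>) (pdom \<phi>) (pcod \<phi>) \<and> pgraph \<phi> \<subseteq> E"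
proof -
  have "pfun \<phi> \<in> measurable (restrict_space mu01 (pdom \<phi>)) (restrict_space mu01 (pcod \<phi>)) \<longleftrightarrow>
        ext0 \<phi> \<in> borel_measurable borel"
    if D: "pdom \<phi> \<subseteq> {0..1}" "pdom \<phi> \<in> sets borel" and C: "pcod \<phi> \<subseteq> {0..1}" "pcod \<phi> \<in> sets borel"
      and bij: "bij_betw (pfun \<phi>) (pdom \<phi>) (pcod \<phi>)"
  proof -
    have 1: "restrict_space mu01 (pdom \<phi>) = restrict_space lborel (pdom \<phi>)"
      using D by (simp add: mu01_def restrict_restrict_space Int_absorb1)
    have 2: "restrict_space mu01 (pcod \<phi>) = restrict_space lborel (pcod \<phi>)"
      using C by (simp add: mu01_def restrict_restrict_space Int_absorb1)
    have "pfun \<phi> \<in> space (restrict_space lborel (pdom \<phi>)) \<rightarrow> pcod \<phi>"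
      using bij by (auto simp: space_restrict_space bij_betw_def)
    then have "pfun \<phi> \<in> measurable (restrict_space mu01 (pdom \<phi>)) (restrict_space mu01 (pcod \<phi>)) \<longleftrightarrow>
        pfun \<phi> \<in> measurable (restrict_space lborel (pdom \<phi>)) lborel"
      unfolding 1 2 by (simp add: measurable_restrict_space2_iff)
    also have "\<dots> \<longleftrightarrow> ext0 \<phi> \<in> measurable lborel lborel"
      using D unfolding ext0_def by (intro measurable_restrict_space_iff) auto
    finally show ?thesis by simp
  qed
  then show ?thesis
    unfolding full_pseudogroup_def mem_Collect_eq sets_mu01 by blast
qed

lemma translation_in_full_pseudogroup:
  assumes "pdom \<phi> = {a<..<b}" "pcod \<phi> = {a + c<..<b + c}" "pfun \<phi> = (\<lambda>x. x + c)"
    and "0 \<le> a" "b \<le> 1" "0 \<le> a + c" "b + c \<le> 1" "pgraph \<phi> \<subseteq> E"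
  shows "\<phi> \<in> full_pseudogroup mu01 E"
proof -
  have "(\<lambda>x. x + c) ` {a<..<b} = {a + c<..<b + c}"
    by (auto simp: image_iff intro!: bexI[of _ "_ - c"])
  moreover have "ext0 \<phi> = (\<lambda>x. if x \<in> {a<..<b} then x + c else 0)"
    using assms by (auto simp: ext0_def)
  ultimately show ?thesis
    using assms by (auto simp: full_pseudogroup_mu01_iff bij_betw_def inj_on_def)
qed

lemma power_half_le_1: "1/2^n \<le> (1::real)"
  by (simp add: field_simps)

lemma ex_family_in_full_pseudogroup:
  assumes "pgraph (ex_family i) \<subseteq> E"
  shows "ex_family i \<in> full_pseudogroup mu01 E"
proof -
  have bound: "3 \<le> 4 * (2::real)^n \<and> 1 \<le> 2 * (2::real)^n" for n
    using one_le_power[of "2::real" n] by linarith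
  show ?thesis
  proof (cases i)
    case Phi1
    with assms show ?thesis
      by (intro translation_in_full_pseudogroup[of _ 0 "1/2" "1/2"]) (auto simp: phi1_def)
  next
    case Phi2
    with assms show ?thesis
      by (intro translation_in_full_pseudogroup[of _ "1/2" 1 0]) (auto simp: phi2_def)
  next
    case (Psi1 n)
    with assms show ?thesis
      using bound
      by (intro translation_in_full_pseudogroup[of _ "1/2^(n+1)" "3/2^(n+2)" "- (1/2^(n+2))"])
         (auto simp: psi1_def)
  next
    case (Psi2 n)
    with assms show ?thesis
      using bound
      by (intro translation_in_full_pseudogroup[of _ "3/2^(n+2)" "1/2^n" "- (1/2^(n+1))"])
         (auto simp: psi2_def)
  qed
qed

section \<open>Binary scales and the multiplicity count\<close>

lemma dyadic_scale_exists:
  fixes x :: real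
  assumes "0 < x" "x < 1"
  obtains n where "1/2^(n+1) < x" "x \<le> 1/2^n"
proof -
  obtain k where "(1/2)^k < x" using assms(1) real_arch_pow_inv[of x "1/2"] by auto
  then have "1/2^(k+1) < x" using assms by (simp add: power_one_over field_simps)
  then have ex: "\<exists>k. 1/2^(k+1) < x" by blast
  \<comment> \<open>For non-dyadic \<open>x\<close> this counts the zeros before the leading binary
    1; minimality yields the upper bound.\<close>
  define n where "n = (LEAST k. 1/2^(k+1) < x)"
  have "1/2^(n+1) < x" unfolding n_def using ex by (rule LeastI_ex)
  moreover have "x \<le> 1/2^n"
  proof (cases n)
    case 0
    then show ?thesis using assms by simp
  next
    case (Suc m)
    then have "\<not> 1/2^(m+1) < x" unfolding n_def by (metis not_less_Least lessI)
    then show ?thesis using Suc by simp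
  qed
  ultimately show ?thesis using that by blast
qed

lemma dyadic_scale_unique:
  fixes x :: real
  assumes "1/2^(n+1) < x" "x \<le> 1/2^n" "1/2^(m+1) < x" "x \<le> 1/2^m"
  shows "m = n"
proof -
  have "\<not> m < n" if "1/2^(m+1) < x" "x \<le> 1/2^n" for m n
  proof
    assume "m < n"
    then have "(2::real)^(m+1) \<le> 2^n" by (intro power_increasing) auto
    then have "1/2^n \<le> (1/2^(m+1)::real)" by (intro divide_left_mono) auto
    with that show False by linarith
  qed
  from this[of m n] this[of n m] show ?thesis using assms by linarith
qed

lemma mem_pdom_psi_scale:
  assumes "x \<in> pdom (psi1 n) \<or> x \<in> pdom (psi2 n)"
  shows "1/2^(n+1) < x" "x \<le> 1/2^n"
proof -
  have "1/2^(n+1) < (3/2^(n+2)::real)" "3/2^(n+2) < (1/2^n::real)"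
    by (auto simp: field_simps)
  with assms show "1/2^(n+1) < x" "x \<le> 1/2^n"
    by (auto simp: psi1_def psi2_def simp del: power_Suc)
qed

text \<open>An irrational point avoids all interval endpoints. Comparison with 1/2 selects the
  phi-map; the scale \<open>n\<close> and comparison with \<open>3/2^(n+2)\<close>, the midpoint of
  that scale, select the psi-map.\<close>

lemma pdom_index_set:
  assumes x: "x \<notin> \<rat>" and n: "1/2^(n+1) < x" "x \<le> 1/2^n"
  shows "{k. x \<in> pdom (ex_family k)} =
    {if x < 1/2 then Phi1 else Phi2, if x < 3/2^(n+2) then Psi1 n else Psi2 n}"
proof -
  have neq: "x \<noteq> 1/2^n" "x \<noteq> 3/2^(n+2)" "x \<noteq> 1/2" using x Rats_divide by fastforce+
  have pos: "0 < x" by (rule less_trans[OF _ n(1)]) simp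
  have lt1: "x < 1" using neq n power_half_le_1[of n] by linarith
  have phi: "x \<in> pdom phi1 \<longleftrightarrow> x < 1/2" "x \<in> pdom phi2 \<longleftrightarrow> \<not> x < 1/2"
    using pos lt1 neq by (auto simp: phi1_def phi2_def)
  have psi: "x \<in> pdom (psi1 n) \<longleftrightarrow> x < 3/2^(n+2)" "x \<in> pdom (psi2 n) \<longleftrightarrow> \<not> x < 3/2^(n+2)"
    using n neq by (auto simp: psi1_def psi2_def)
  have scale: "x \<in> pdom (psi1 m) \<or> x \<in> pdom (psi2 m) \<Longrightarrow> m = n" for m
    using dyadic_scale_unique[OF n mem_pdom_psi_scale] by blast
  show ?thesis
  proof (intro set_eqI)
    fix k
    show "k \<in> {k. x \<in> pdom (ex_family k)} \<longleftrightarrow>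
      k \<in> {if x < 1/2 then Phi1 else Phi2, if x < 3/2^(n+2) then Psi1 n else Psi2 n}"
      using phi psi scale by (cases k) (auto split: if_splits)
  qed
qed

lemma pcod_psi: "pcod (psi1 n) = {1/2^(n+2)<..<1/2^(n+1)}" "pcod (psi2 n) = {1/2^(n+2)<..<1/2^(n+1)}"
  by (simp_all add: psi1_def psi2_def)

text \<open>Scale 0 is the common range of the two phi-maps. The maps of index \<open>m\<close>
  among the psi-maps start at scale \<open>m\<close> but land at scale \<open>m+1\<close>, so scale
  \<open>n\<close> is hit by index \<open>n - 1\<close>.\<close>

lemma pcod_two_indices:
  assumes x: "x \<notin> \<rat>" "0 \<le> x" "x \<le> 1"
  obtains i j where "i \<noteq> j" "{k. x \<in> pcod (ex_family k)} = {i, j}"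
proof -
  have neq: "x \<noteq> 0" "x \<noteq> 1" "x \<noteq> 1/2" using x Rats_divide by fastforce+
  then obtain n where n: "1/2^(n+1) < x" "x \<le> 1/2^n"
    using dyadic_scale_exists[of x] x by force
  have "x \<noteq> 1/2^n" using x by auto
  with n have n': "1/2^(n+1) < x" "x < 1/2^n" by auto
  have psi: "x \<in> pcod (psi1 m) \<Longrightarrow> Suc m = n" "x \<in> pcod (psi2 m) \<Longrightarrow> Suc m = n" for m
    using dyadic_scale_unique[OF n, of "Suc m"] by (auto simp: pcod_psi)
  show ?thesis
  proof (cases n)
    case 0
    then have "{k. x \<in> pcod (ex_family k)} = {Phi1, Phi2}"
    proof (intro set_eqI)
      fix k
      show "k \<in> {k. x \<in> pcod (ex_family k)} \<longleftrightarrow> k \<in> {Phi1, Phi2}"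
        using psi 0 n' by (cases k) (auto simp: phi1_def phi2_def)
    qed
    then show ?thesis using that[of Phi1 Phi2] by simp
  next
    case (Suc m)
    have "1/2^n \<le> (1/2::real)" using Suc power_half_le_1[of m] by simp
    then have "x < 1/2" using n' by linarith
    have mem: "x \<in> pcod (psi1 m)" "x \<in> pcod (psi2 m)"
      using n' Suc by (simp_all add: pcod_psi)
    have "x \<in> pcod (psi1 k) \<longleftrightarrow> k = m" "x \<in> pcod (psi2 k) \<longleftrightarrow> k = m" for k
      using psi[of k] mem Suc by blast+
    moreover have "x \<notin> pcod phi1" "x \<notin> pcod phi2"
      using \<open>x < 1/2\<close> by (auto simp: phi1_def phi2_def)
    ultimately have "x \<in> pcod (ex_family k) \<longleftrightarrow> k \<in> {Psi1 m, Psi2 m}" for k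
      by (cases k) simp_all
    then have "{k. x \<in> pcod (ex_family k)} = {Psi1 m, Psi2 m}" by blast
    then show ?thesis using that[of "Psi1 m" "Psi2 m"] by simp
  qed
qed

lemma countable_ex_index: "countable (UNIV :: ex_index set)"
proof -
  have "UNIV = {Phi1, Phi2} \<union> range Psi1 \<union> range Psi2"
    using ex_index.exhaust by blast
  then show ?thesis by (metis countable_Un countable_finite countable_image countableI_type finite.emptyI finite.insertI)
qed

lemma infsum_two:
  fixes f :: "'i \<Rightarrow> 'b :: {topological_comm_monoid_add, t2_space}"
  assumes "i \<noteq> j" "\<And>k. k \<notin> {i, j} \<Longrightarrow> f k = 0"
  shows "infsum f UNIV = f i + f j"
proof -
  have "infsum f UNIV = infsum f {i, j}"
    using assms(2) by (intro infsum_cong_neutral) auto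
  also have "\<dots> = f i + f j" using assms(1) by simp
  finally show ?thesis .
qed

lemma pdom_two_indices:
  assumes x: "x \<notin> \<rat>" "0 \<le> x" "x \<le> 1"
  obtains i j where "i \<noteq> j" "{k. x \<in> pdom (ex_family k)} = {i, j}"
proof -
  have neq: "x \<noteq> 0" "x \<noteq> 1" using x by auto
  then obtain n where "1/2^(n+1) < x" "x \<le> 1/2^n"
    using dyadic_scale_exists[of x] x by force
  from pdom_index_set[OF x(1) this] show ?thesis
    by (rule that[rotated]) auto
qed

lemma ex_family_DSE:
  assumes "\<And>i. pgraph (ex_family i) \<subseteq> E"
  shows "DSE mu01 E 2 UNIV ex_family"
proof -
  have two: "(\<Sum>\<^sub>\<infinity>k. indicator (S k) x :: ennreal) = of_nat 2"
    if ij: "i \<noteq> j" "{k. x \<in> S k} = {i, j}" for S :: "ex_index \<Rightarrow> real set" and i j x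
  proof -
    have "x \<in> S k \<longleftrightarrow> k \<in> {i, j}" for k using ij(2) by blast
    then have "(\<Sum>\<^sub>\<infinity>k. indicator (S k) x :: ennreal) = 1 + 1"
      using ij(1) by (subst infsum_two[of i j]) (auto simp: indicator_def)
    then show ?thesis by simp
  qed
  have "AE x in mu01. (\<Sum>\<^sub>\<infinity>k. indicator (pdom (ex_family k)) x :: ennreal) = of_nat 2"
    unfolding AE_mu01_iff using AE_irrational
    by eventually_elim (metis two pdom_two_indices atLeastAtMost_iff)
  moreover have "AE x in mu01. (\<Sum>\<^sub>\<infinity>k. indicator (pcod (ex_family k)) x :: ennreal) = of_nat 2"
    unfolding AE_mu01_iff using AE_irrational
    by eventually_elim (metis two pcod_two_indices atLeastAtMost_iff)
  ultimately show ?thesis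
    using assms countable_ex_index by (auto simp: DSE_def intro: ex_family_in_full_pseudogroup)
qed

text \<open>Disjoint domains make the glued map well defined, disjoint codomains make it injective,
  and measurability is checked on the countably many pieces.\<close>

lemma glue_full_pseudogroup:
  assumes \<psi>: "\<And>n :: nat. \<psi> n \<in> full_pseudogroup M E"
    and dom: "\<And>m n x. x \<in> pdom (\<psi> m) \<Longrightarrow> x \<in> pdom (\<psi> n) \<Longrightarrow> m = n"
    and cod: "\<And>m n y. y \<in> pcod (\<psi> m) \<Longrightarrow> y \<in> pcod (\<psi> n) \<Longrightarrow> m = n"
  shows "\<exists>g\<in>full_pseudogroup M E. pdom g = (\<Union>n. pdom (\<psi> n)) \<and>
    pcod g = (\<Union>n. pcod (\<psi> n)) \<and> (\<forall>n. \<forall>x\<in>pdom (\<psi> n). pfun g x = pfun (\<psi> n) x)"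
proof -
  define f where "f x = pfun (\<psi> (THE n. x \<in> pdom (\<psi> n))) x" for x
  define g where "g = \<lparr>pdom = \<Union>n. pdom (\<psi> n), pcod = \<Union>n. pcod (\<psi> n), pfun = f\<rparr>"
  have f: "f x = pfun (\<psi> n) x" if "x \<in> pdom (\<psi> n)" for x n
  proof -
    have "(THE n. x \<in> pdom (\<psi> n)) = n" using that dom by blast
    then show ?thesis by (simp add: f_def)
  qed
  have bij: "bij_betw (pfun (\<psi> n)) (pdom (\<psi> n)) (pcod (\<psi> n))"
    and D: "pdom (\<psi> n) \<in> sets M" and C: "pcod (\<psi> n) \<in> sets M"
    and meas: "pfun (\<psi> n) \<in> measurable (restrict_space M (pdom (\<psi> n))) (restrict_space M (pcod (\<psi> n)))"
    and graph: "pgraph (\<psi> n) \<subseteq> E" for n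
    using \<psi>[of n] by (auto simp: full_pseudogroup_def)
  have img: "f ` pdom (\<psi> n) = pcod (\<psi> n)" for n
    using bij[of n] f by (auto simp: bij_betw_def)
  have "bij_betw f (\<Union>n. pdom (\<psi> n)) (\<Union>n. pcod (\<psi> n))"
    unfolding bij_betw_def
  proof
    show "inj_on f (\<Union>n. pdom (\<psi> n))"
    proof (rule inj_onI)
      fix x y
      assume "x \<in> (\<Union>n. pdom (\<psi> n))" "y \<in> (\<Union>n. pdom (\<psi> n))" and eq: "f x = f y"
      then obtain m n where mn: "x \<in> pdom (\<psi> m)" "y \<in> pdom (\<psi> n)" by blast
      then have "m = n" using cod[of "f x"] img eq by blast
      then show "x = y" using mn eq f bij[of n] by (metis bij_betw_def inj_on_def)
    qed
    show "f ` (\<Union>n. pdom (\<psi> n)) = (\<Union>n. pcod (\<psi> n))" by (simp add: image_UN img)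
  qed
  moreover have "f \<in> measurable (restrict_space M (\<Union>n. pdom (\<psi> n))) (restrict_space M (\<Union>n. pcod (\<psi> n)))"
  proof (rule measurable_piecewise_restrict[where C = "range (\<lambda>n. pdom (\<psi> n))"])
    fix S assume "S \<in> range (\<lambda>n. pdom (\<psi> n))"
    then obtain n where S: "S = pdom (\<psi> n)" by blast
    have sub: "S \<subseteq> space M" using D[of n] S sets.sets_into_space by blast
    have US: "(\<Union>n. pdom (\<psi> n)) \<in> sets M" "(\<Union>n. pdom (\<psi> n)) \<inter> space M \<in> sets M" using D by auto
    show "S \<inter> space (restrict_space M (\<Union>n. pdom (\<psi> n))) \<in> sets (restrict_space M (\<Union>n. pdom (\<psi> n)))"
      using US D[of n] sub S by (auto simp: sets_restrict_space_iff space_restrict_space)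
    have "restrict_space (restrict_space M (\<Union>n. pdom (\<psi> n))) S = restrict_space M S"
      using US D[of n] S by (subst restrict_restrict_space) (auto intro!: arg_cong[where f = "restrict_space M"])
    moreover have "f \<in> measurable (restrict_space M S) M"
    proof (subst measurable_cong)
      show "f w = pfun (\<psi> n) w" if "w \<in> space (restrict_space M S)" for w
        using that f S by (auto simp: space_restrict_space)
      show "pfun (\<psi> n) \<in> measurable (restrict_space M S) M"
        using meas[of n] S by (simp add: measurable_restrict_space2_iff)
    qed
    moreover have "f \<in> space (restrict_space M S) \<rightarrow> (\<Union>n. pcod (\<psi> n))"
      using img[of n] S by (auto simp: space_restrict_space)
    ultimately show "f \<in> measurable (restrict_space (restrict_space M (\<Union>n. pdom (\<psi> n))) S)
        (restrict_space M (\<Union>n. pcod (\<psi> n)))"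
      by (simp add: measurable_restrict_space2_iff)
  qed (auto simp: space_restrict_space)
  moreover have "pgraph g \<subseteq> E"
    using graph f by (force simp: pgraph_def g_def)
  ultimately have "g \<in> full_pseudogroup M E"
    using D C by (auto simp: full_pseudogroup_def g_def)
  then show ?thesis
    by (rule bexI[rotated]) (auto simp: g_def f)
qed

text \<open>The open codomains omit the dyadic points \<open>1/2^(n+1)\<close>; irrationality
  excludes them, which is why the glued range is \<open>(0, 1/2)\<close> only up to a null
  set.\<close>

lemma UN_pcod_psi:
  assumes "x \<notin> \<rat>"
  shows "(\<exists>n. x \<in> {1/2^(n+2)<..<1/2^(n+1)}) \<longleftrightarrow> x \<in> {0<..<1/2::real}"
proof
  assume "\<exists>n. x \<in> {1/2^(n+2)<..<1/2^(n+1)}"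
  then obtain n where n: "1/2^(n+2) < x" "x < 1/2^(n+1)" by auto
  have "(0::real) < 1/2^(n+2)" by simp
  moreover have "1/2^(n+1) \<le> (1/2::real)" using power_half_le_1[of n] by simp
  ultimately have "0 < x" "x < 1/2" using n by linarith+
  then show "x \<in> {0<..<1/2}" by simp
next
  assume x: "x \<in> {0<..<1/2}"
  \<comment> \<open>The codomain of index \<open>n\<close> is scale \<open>n+1\<close>, so doubling
    \<open>x\<close> produces the right index.\<close>
  obtain n where n: "1/2^(n+1) < 2 * x" "2 * x \<le> 1/2^n"
    using dyadic_scale_exists[of "2 * x"] x by auto
  moreover have "x \<noteq> 1/2^(n+1)" using assms Rats_divide by fastforce
  ultimately have "1/2^(n+2) < x" "x < 1/2^(n+1)" by (auto simp: field_simps)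
  then show "\<exists>n. x \<in> {1/2^(n+2)<..<1/2^(n+1)}" by auto
qed

lemma psi_glue:
  assumes "\<And>i. pgraph (ex_family i) \<subseteq> E" and "\<psi> \<in> {psi1, psi2}"
  shows "\<exists>g. glues_onto mu01 E \<psi> {0<..<1/2} g"
proof -
  have fp: "\<psi> n \<in> full_pseudogroup mu01 E" for n
    using assms(2) ex_family_in_full_pseudogroup[OF assms(1), of "Psi1 n"]
      ex_family_in_full_pseudogroup[OF assms(1), of "Psi2 n"]
    by auto
  have dom: "m = n" if "x \<in> pdom (\<psi> m)" "x \<in> pdom (\<psi> n)" for x m n
    using dyadic_scale_unique[OF mem_pdom_psi_scale[of x n] mem_pdom_psi_scale[of x m]] assms(2) that by blast
  have pcod: "pcod (\<psi> n) = {1/2^(n+2)<..<1/2^(n+1)}" for n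
    using assms(2) pcod_psi by blast
  have cod: "m = n" if "y \<in> pcod (\<psi> m)" "y \<in> pcod (\<psi> n)" for y m n
    using dyadic_scale_unique[of "n+1" y "m+1"] that by (simp add: pcod)
  obtain g where g: "g \<in> full_pseudogroup mu01 E" "pdom g = (\<Union>n. pdom (\<psi> n))"
    "pcod g = (\<Union>n. pcod (\<psi> n))" "\<forall>n. \<forall>x\<in>pdom (\<psi> n). pfun g x = pfun (\<psi> n) x"
    using glue_full_pseudogroup[of \<psi> mu01 E] fp dom cod by metis
  have "AE x in mu01. x \<in> pcod g \<longleftrightarrow> x \<in> {0<..<1/2}"
    unfolding AE_mu01_iff g(3) pcod UN_iff using AE_irrational
    by eventually_elim (use UN_pcod_psi in blast)
  with g have "glues_onto mu01 E \<psi> {0<..<1/2} g"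
    unfolding glues_onto_def by blast
  then show ?thesis ..
qed

section \<open>Indecomposability\<close>

lemma dse_matrix_ex_family:
  assumes "i \<noteq> j" "{k. x \<in> pdom (ex_family k)} = {i, j}"
  shows "dse_matrix UNIV ex_family (x, y) =
     of_bool (y = pfun (ex_family i) x) + of_bool (y = pfun (ex_family j) x)"
proof -
  have "x \<in> pdom (ex_family k) \<longleftrightarrow> k \<in> {i, j}" for k using assms(2) by blast
  then show ?thesis
    unfolding dse_matrix_def using assms(1)
    by (subst infsum_two[of i j]) (auto simp: indicator_def mem_pgraph_iff)
qed

text \<open>Testing at \<open>a\<close> and \<open>b\<close> suffices because these two values
  already account for the total count 2, also when they coincide. In the application only such
  \<open>y\<close> are known to give pairs in \<open>E\<close>.\<close>

lemma two_point_count: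
  fixes a b u v :: 'a
  assumes "\<And>y. y \<in> {a, b} \<Longrightarrow>
    of_bool (y = u) + of_bool (y = v) = (of_bool (y = a) + of_bool (y = b) :: ennreal)"
  shows "u = a \<and> v = b \<or> u = b \<and> v = a"
  using assms[of a] assms[of b] by (auto split: if_splits simp: of_bool_def)

text \<open>The integrand of \<^const>\<open>counting_nu\<close> is not obviously measurable, so vanishing of
  the integral is exploited only through indicators of Borel sets below it.\<close>

lemma decomposition_pointwise:
  assumes E: "E \<subseteq> {0..1} \<times> {0..1}" and graph: "\<And>i. pgraph (ex_family i) \<subseteq> E"
    and dec: "decomposable mu01 E 2 UNIV ex_family"
  obtains \<theta>1 \<theta>2 where "\<theta>1 \<in> full_group mu01 E" "\<theta>2 \<in> full_group mu01 E"
    "AE x in lborel. x \<in> {0..1} \<longrightarrow> x \<in> pdom \<theta>1 \<and> x \<in> pdom \<theta>2 \<and>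
      (\<forall>i j. i \<noteq> j \<and> x \<in> pdom (ex_family i) \<and> x \<in> pdom (ex_family j) \<longrightarrow>
         pfun \<theta>1 x = pfun (ex_family i) x \<and> pfun \<theta>2 x = pfun (ex_family j) x \<or>
         pfun \<theta>1 x = pfun (ex_family j) x \<and> pfun \<theta>2 x = pfun (ex_family i) x)"
proof -
  from dec[unfolded decomposable_def] obtain \<theta> :: "nat \<Rightarrow> real pmap" where
    *: "(\<forall>j\<in>{1..2}. \<theta> j \<in> full_group mu01 E) \<and>
      counting_nu mu01 {p \<in> E. (\<Sum>j=1..2. indicator (pgraph (\<theta> j)) p)
       \<noteq> dse_matrix UNIV ex_family p} = 0" (is "_ \<and> counting_nu _ ?C = 0") ..
  note \<theta> = *[THEN conjunct1, rule_format] and nu = *[THEN conjunct2]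
  define t where "t = \<theta> 1"
  define s where "s = \<theta> 2"
  have sum12: "(\<Sum>j=1..2. f j) = f 1 + f (2::nat)" for f :: "nat \<Rightarrow> ennreal"
    by (simp add: numeral_2_eq_2)
  have t: "t \<in> full_group mu01 E" and s: "s \<in> full_group mu01 E"
    using \<theta> by (auto simp: t_def s_def)
  then have tp: "t \<in> full_pseudogroup mu01 E" and sp: "s \<in> full_pseudogroup mu01 E"
    by (auto simp: full_group_def)
  note phip = ex_family_in_full_pseudogroup[OF graph]
  define ok where "ok i j x \<longleftrightarrow>
         ext0 t x = ext0 (ex_family i) x \<and> ext0 s x = ext0 (ex_family j) x \<or>
         ext0 t x = ext0 (ex_family j) x \<and> ext0 s x = ext0 (ex_family i) x" for i j x
  have null: "AE x in lborel. x \<in> pdom t \<inter> pdom s \<inter> pdom (ex_family i) \<inter> pdom (ex_family j) \<longrightarrow> ok i j x"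
    if ij: "i \<noteq> j" for i j
  proof -
    have [measurable]: "ext0 t \<in> borel_measurable borel" "ext0 s \<in> borel_measurable borel"
        "\<And>k. ext0 (ex_family k) \<in> borel_measurable borel"
        "pdom t \<in> sets borel" "pdom s \<in> sets borel" "\<And>k. pdom (ex_family k) \<in> sets borel"
      using tp sp phip by (auto simp: full_pseudogroup_mu01_iff)
    note [measurable] = Rats_in_borel
    define D where "D = pdom t \<inter> pdom s \<inter> pdom (ex_family i) \<inter> pdom (ex_family j) - \<rat>"
    \<comment> \<open>The bad set for one fixed pair of indices is Borel; there are only countably
      many pairs.\<close>
    define B where "B = {x \<in> D. \<not> ok i j x}"
    have [measurable]: "D \<in> sets borel" unfolding D_def by measurable
    have [measurable]: "B \<in> sets borel" unfolding B_def ok_def by measurable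
    have B01: "B \<subseteq> {0..1}" using tp by (auto simp: B_def D_def full_pseudogroup_mu01_iff)
    \<comment> \<open>At a bad point some \<open>y\<close> is counted wrongly, so row
      \<open>x\<close> of \<open>?C\<close> is nonempty and its counting measure is at least
      1.\<close>
    have "indicator B x \<le> emeasure (count_space UNIV) (?C \<inter> ({x} \<times> space mu01))" for x
    proof (cases "x \<in> B")
      case True
      then have x: "x \<notin> \<rat>" "x \<in> pdom t" "x \<in> pdom s" "x \<in> pdom (ex_family i)" "x \<in> pdom (ex_family j)"
        and nok: "\<not> ok i j x" by (auto simp: B_def D_def)
      have "x \<in> {0..1}" using True B01 by auto
      then obtain i' j' where ij': "i' \<noteq> j'" "{k. x \<in> pdom (ex_family k)} = {i', j'}"
        using pdom_two_indices[OF x(1)] by auto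
      moreover have "i \<in> {i', j'}" "j \<in> {i', j'}" using ij'(2) x(4,5) by blast+
      ultimately have idx: "{k. x \<in> pdom (ex_family k)} = {i, j}" using ij by auto
      let ?a = "pfun (ex_family i) x" let ?b = "pfun (ex_family j) x"
      have "\<exists>y\<in>{?a, ?b}. of_bool (y = pfun t x) + of_bool (y = pfun s x)
          \<noteq> (of_bool (y = ?a) + of_bool (y = ?b) :: ennreal)"
        using two_point_count[of ?a ?b "pfun t x" "pfun s x"] nok x by (auto simp: ok_def ext0_def)
      then obtain y where y: "y \<in> {?a, ?b}" and ne: "of_bool (y = pfun t x) + of_bool (y = pfun s x)
          \<noteq> (of_bool (y = ?a) + of_bool (y = ?b) :: ennreal)" by blast
      have "(x, y) \<in> pgraph (ex_family i) \<or> (x, y) \<in> pgraph (ex_family j)"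
        using y x by (auto simp: mem_pgraph_iff)
      then have "(x, y) \<in> E" using graph by blast
      moreover have "(\<Sum>j=1..2. indicator (pgraph (\<theta> j)) (x, y) :: ennreal)
          = of_bool (y = pfun t x) + of_bool (y = pfun s x)"
        unfolding sum12 t_def[symmetric] s_def[symmetric] using x by (simp add: indicator_def mem_pgraph_iff)
      ultimately have "(x, y) \<in> ?C \<inter> ({x} \<times> space mu01)"
        using ne dse_matrix_ex_family[OF ij idx, of y] E by auto
      then have "emeasure (count_space UNIV) {(x, y)} \<le> emeasure (count_space UNIV) (?C \<inter> ({x} \<times> space mu01))"
        by (intro emeasure_mono) auto
      then show ?thesis using True by simp
    qed simp
    then have "(\<integral>\<^sup>+x. indicator B x \<partial>mu01) \<le> counting_nu mu01 ?C"
      unfolding counting_nu_def by (intro nn_integral_mono)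
    moreover have "B \<in> sets mu01" using B01 by (simp add: sets_mu01)
    ultimately have "emeasure lborel B = 0"
      using nu B01 by (simp add: emeasure_mu01)
    then have "AE x in lborel. x \<notin> B" by (intro AE_not_in) (auto simp: null_sets_def)
    then show ?thesis
      using AE_irrational by eventually_elim (auto simp: B_def D_def)
  qed
  have "AE x in lborel. \<forall>i j. i \<noteq> j \<longrightarrow>
      x \<in> pdom t \<inter> pdom s \<inter> pdom (ex_family i) \<inter> pdom (ex_family j) \<longrightarrow> ok i j x"
    using null countable_ex_index
    by (simp add: AE_ball_countable[of UNIV, simplified])
  moreover have "AE x in lborel. x \<in> {0..1} \<longrightarrow> x \<in> pdom t" "AE x in lborel. x \<in> {0..1} \<longrightarrow> x \<in> pdom s"
    using t s by (auto simp: full_group_def AE_mu01_iff)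
  ultimately have "AE x in lborel. x \<in> {0..1} \<longrightarrow> x \<in> pdom t \<and> x \<in> pdom s \<and>
      (\<forall>i j. i \<noteq> j \<and> x \<in> pdom (ex_family i) \<and> x \<in> pdom (ex_family j) \<longrightarrow>
         pfun t x = pfun (ex_family i) x \<and> pfun s x = pfun (ex_family j) x \<or>
         pfun t x = pfun (ex_family j) x \<and> pfun s x = pfun (ex_family i) x)"
    by eventually_elim (auto simp: ok_def ext0_def)
  with t s show ?thesis by (rule that)
qed

lemma ex_family_not_decomposable:
  assumes E: "E \<subseteq> {0..1} \<times> {0..1}" and graph: "\<And>i. pgraph (ex_family i) \<subseteq> E"
  shows "\<not> decomposable mu01 E 2 UNIV ex_family"
proof
  assume "decomposable mu01 E 2 UNIV ex_family"
  from decomposition_pointwise[OF E graph this] obtain t s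
    where ts: "t \<in> full_group mu01 E" "s \<in> full_group mu01 E"
    and ae: "AE x in lborel. x \<in> {0..1} \<longrightarrow> x \<in> pdom t \<and> x \<in> pdom s \<and>
      (\<forall>i j. i \<noteq> j \<and> x \<in> pdom (ex_family i) \<and> x \<in> pdom (ex_family j) \<longrightarrow>
         pfun t x = pfun (ex_family i) x \<and> pfun s x = pfun (ex_family j) x \<or>
         pfun t x = pfun (ex_family j) x \<and> pfun s x = pfun (ex_family i) x)"
    by blast
  have inj: "inj_on (pfun t) (pdom t)" "inj_on (pfun s) (pdom s)"
    using ts by (auto simp: full_group_def full_pseudogroup_def bij_betw_def)
  have tp: "t \<in> full_pseudogroup mu01 E" using ts by (simp add: full_group_def)
  define good where "good x \<longleftrightarrow> x \<notin> \<rat> \<and> (x \<in> {0..1} \<longrightarrow> x \<in> pdom t \<and> x \<in> pdom s \<and>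
      (\<forall>i j. i \<noteq> j \<and> x \<in> pdom (ex_family i) \<and> x \<in> pdom (ex_family j) \<longrightarrow>
         pfun t x = pfun (ex_family i) x \<and> pfun s x = pfun (ex_family j) x \<or>
         pfun t x = pfun (ex_family j) x \<and> pfun s x = pfun (ex_family i) x))" for x
  have "AE x in lborel. good x"
    unfolding good_def using ae AE_irrational by eventually_elim simp
  \<comment> \<open>A point and its flip partner differ by a rational, so both can be taken good at
    once.\<close>
  then have good: "AE x in lborel. \<forall>q\<in>\<rat>. good (x + q)"
    by (rule AE_rational_shifts)
  \<comment> \<open>Pigeonhole: at each of \<open>x\<close> and \<open>y\<close> the common image is
    reached by \<open>t\<close> or by \<open>s\<close>, and injectivity lets each of them reach it
    from only one of the two points.\<close>
  have split: "pfun t x = pfun (ex_family i) x \<longleftrightarrow> pfun t y \<noteq> pfun (ex_family k) y"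
    if x: "good x" "x \<in> {0..1}" "x \<in> pdom (ex_family i)" and y: "good y" "y \<in> {0..1}" "y \<in> pdom (ex_family k)"
      and eq: "pfun (ex_family i) x = pfun (ex_family k) y" and "x \<noteq> y" for x y i k
  proof -
    have dom: "x \<in> pdom t" "x \<in> pdom s" "y \<in> pdom t" "y \<in> pdom s"
      using x y by (auto simp: good_def)
    have or: "pfun t z = pfun (ex_family l) z \<or> pfun s z = pfun (ex_family l) z"
      if z: "good z" "z \<in> {0..1}" "z \<in> pdom (ex_family l)" for z l
    proof -
      obtain i j where "i \<noteq> j" "{k. z \<in> pdom (ex_family k)} = {i, j}"
        using pdom_two_indices[of z] z by (auto simp: good_def)
      then have "\<exists>l'. l' \<noteq> l \<and> z \<in> pdom (ex_family l')"
        by (metis insertCI mem_Collect_eq)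
      then show ?thesis using z unfolding good_def by blast
    qed
    have "pfun t x \<noteq> pfun t y" "pfun s x \<noteq> pfun s y"
      using inj dom \<open>x \<noteq> y\<close> by (auto dest: inj_onD)
    then show ?thesis using or[OF x] or[OF y] eq by metis
  qed
  \<comment> \<open>The right-hand side is the value of the phi-map defined at \<open>x\<close>;
    phrased through \<open>ext0 t\<close>, the condition is visibly Borel.\<close>
  define A where "A = {x \<in> pdom t. ext0 t x = (if x < 1/2 then x + 1/2 else x)}"
  have [measurable]: "ext0 t \<in> borel_measurable borel" "pdom t \<in> sets borel"
    using tp by (auto simp: full_pseudogroup_mu01_iff)
  have "A \<in> sets borel" unfolding A_def by measurable
  then show False
  proof (rule no_measurable_digit_flip)
    have A_phi: "x \<in> A \<longleftrightarrow> pfun t x = (if x < 1/2 then x + 1/2 else x)"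
      if "good x" "x \<in> {0..1}" for x
      using that by (auto simp: A_def good_def ext0_def)
    show "AE x in lborel. 0 < x \<and> x < 1/2 \<longrightarrow> (x \<in> A \<longleftrightarrow> x + 1/2 \<notin> A)"
      using good
    proof (eventually_elim, safe)
      fix x :: real
      assume g: "\<forall>q\<in>\<rat>. good (x + q)" and x: "0 < x" "x < 1/2"
      have gx: "good x" "good (x + 1/2)" using g[rule_format, of 0] g[rule_format, of "1/2"] by auto
      have "pfun t x = pfun (ex_family Phi1) x \<longleftrightarrow> pfun t (x + 1/2) \<noteq> pfun (ex_family Phi2) (x + 1/2)"
        using gx x by (intro split) (auto simp: phi1_def phi2_def)
      then have "x \<in> A \<longleftrightarrow> x + 1/2 \<notin> A"
        using A_phi[OF gx(1)] A_phi[OF gx(2)] x by (auto simp: phi1_def phi2_def)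
      then show "x \<in> A \<Longrightarrow> x + 1/2 \<in> A \<Longrightarrow> False" "x + 1/2 \<notin> A \<Longrightarrow> x \<in> A" by blast+
    qed
    \<comment> \<open>Phi-values are at least 1/2 and psi-values are below 1/2, so they never
      coincide and \<open>t\<close> follows exactly one of the two maps.\<close>
    have A_psi: "x \<in> A \<longleftrightarrow> pfun t x \<noteq> pfun (ex_family k) x"
      if x: "good x" "x \<in> {0..1}" and k: "k = Psi1 m \<or> k = Psi2 m" "x \<in> pdom (ex_family k)" for x k m
    proof -
      have irr: "x \<notin> \<rat>" using x by (simp add: good_def)
      then have "x \<noteq> 0" "x \<noteq> 1" "x \<noteq> 1/2" using Rats_divide by fastforce+
      define i where "i = (if x < 1/2 then Phi1 else Phi2)"
      have i: "x \<in> pdom (ex_family i)" "pfun (ex_family i) x = (if x < 1/2 then x + 1/2 else x)" "i \<noteq> k"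
        using x k \<open>x \<noteq> 0\<close> \<open>x \<noteq> 1\<close> \<open>x \<noteq> 1/2\<close> by (auto simp: i_def phi1_def phi2_def)
      have "pfun (ex_family k) x \<in> pcod (ex_family k)"
        using ex_family_in_full_pseudogroup[OF graph, of k] k(2)
        by (auto simp: full_pseudogroup_def bij_betw_def)
      then have "pfun (ex_family k) x < 1/2^(m+1)" using k(1) by (auto simp: pcod_psi)
      moreover have "1/2^(m+1) \<le> (1/2::real)" using power_half_le_1[of m] by simp
      ultimately have "pfun (ex_family k) x < 1/2" by linarith
      then have "pfun (ex_family k) x \<noteq> pfun (ex_family i) x" using i(2) x \<open>x \<noteq> 1/2\<close> by auto
      then show ?thesis
        using x i k A_phi[OF x] unfolding good_def by metis
    qed
    fix n :: nat assume "n \<ge> 1"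
    then obtain m where m: "n = Suc m" by (cases n) auto
    show "AE x in lborel. 1/2^n < x \<and> x < 1/2^n + 1/2^(n+1) \<longrightarrow> (x \<in> A \<longleftrightarrow> x + 1/2^(n+1) \<notin> A)"
      using good
    proof eventually_elim
      case g: (elim x)
      show ?case
      proof
        assume x: "1/2^n < x \<and> x < 1/2^n + 1/2^(n+1)"
        let ?y = "x + 1/2^(n+1)"
        have gx: "good x" "good ?y" using g[rule_format, of 0] g[rule_format, of "1/2^(n+1)"] by auto
        have dom: "x \<in> pdom (ex_family (Psi1 m))" "?y \<in> pdom (ex_family (Psi2 m))"
          using x m by (auto simp: psi1_def psi2_def field_simps)
        have "pdom (ex_family l) \<subseteq> {0..1}" for l
          using ex_family_in_full_pseudogroup[OF graph, of l] by (simp only: full_pseudogroup_mu01_iff)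
        with dom have I: "x \<in> {0..1}" "?y \<in> {0..1}" by blast+
        \<comment> \<open>The psi-maps describe the complement of \<open>A\<close>; negating both
          sides turns this into the flip relation for \<open>A\<close> itself.\<close>
        have "pfun t x = pfun (ex_family (Psi1 m)) x \<longleftrightarrow> pfun t ?y \<noteq> pfun (ex_family (Psi2 m)) ?y"
          using gx dom I by (intro split) (auto simp: psi1_def psi2_def m field_simps)
        then show "x \<in> A \<longleftrightarrow> ?y \<notin> A"
          using A_psi[OF gx(1) I(1), of "Psi1 m" m] A_psi[OF gx(2) I(2), of "Psi2 m" m] dom by blast
      qed
    qed
  qed
qed

section \<open>The rational translation relation\<close>

text \<open>The Vitali equivalence relation on the unit interval. All maps of the family are
  translations by rationals and hence respect it.\<close>

definition rational_rel :: "(real \<times> real) set" where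
  "rational_rel = {(x, y). x \<in> {0..1} \<and> y \<in> {0..1} \<and> y - x \<in> \<rat>}"

lemma equiv_rational_rel: "equiv {0..1} rational_rel"
proof (rule equivI)
  show "sym rational_rel"
  proof (rule symI)
    fix x y assume "(x, y) \<in> rational_rel"
    then show "(y, x) \<in> rational_rel"
      using Rats_minus_iff[of "y - x"] by (auto simp: rational_rel_def)
  qed
  show "trans rational_rel"
  proof (rule transI)
    fix x y z assume "(x, y) \<in> rational_rel" "(y, z) \<in> rational_rel"
    then show "(x, z) \<in> rational_rel"
      using Rats_add[of "z - y" "y - x"] by (auto simp: rational_rel_def)
  qed
qed (auto simp: rational_rel_def refl_on_def)

text \<open>Such a map is a translation by a rational on each of countably many Borel pieces, so
  translation invariance and countable additivity suffice.\<close>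

lemma rational_rel_preserves_measure:
  assumes \<phi>: "\<phi> \<in> full_pseudogroup mu01 rational_rel"
  shows "preserves_measure mu01 \<phi>"
  unfolding preserves_measure_def
proof (intro ballI impI)
  fix C assume C: "C \<in> sets mu01" "C \<subseteq> pcod \<phi>"
  have [measurable]: "C \<in> sets borel" and C01: "C \<subseteq> {0..1}"
    using C by (auto simp: sets_mu01)
  have [measurable]: "pdom \<phi> \<in> sets borel" "ext0 \<phi> \<in> borel_measurable borel"
    and D01: "pdom \<phi> \<subseteq> {0..1}" and bij: "bij_betw (pfun \<phi>) (pdom \<phi>) (pcod \<phi>)"
    and graph: "pgraph \<phi> \<subseteq> rational_rel"
    using \<phi> by (auto simp: full_pseudogroup_mu01_iff)
  define P where "P q = {x \<in> pdom \<phi>. ext0 \<phi> x = x + q \<and> x + q \<in> C}" for q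
  \<comment> \<open>The image of \<open>P q\<close> under translation by \<open>q\<close>, written
    as a preimage so that it is Borel and has the measure of \<open>P q\<close>. The sets
    \<open>P q\<close> are disjoint because \<open>q\<close> is the displacement, the sets
    \<open>Q q\<close> because the map is injective.\<close>
  define Q where "Q q = (\<lambda>y. - q + y) -` P q" for q
  have P[measurable]: "P q \<in> sets borel" for q unfolding P_def by measurable
  have Qm[measurable]: "Q q \<in> sets borel" for q
    unfolding Q_def by (rule measurable_sets_borel[OF _ P]) simp
  have inj: "inj_on (pfun \<phi>) (pdom \<phi>)" using bij by (simp add: bij_betw_def)
  have pre: "pfun \<phi> -` C \<inter> pdom \<phi> = (\<Union>q\<in>\<rat>. P q)"
  proof (intro set_eqI iffI)
    fix x assume x: "x \<in> pfun \<phi> -` C \<inter> pdom \<phi>"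
    then have "pfun \<phi> x - x \<in> \<rat>"
      using graph by (auto simp: mem_pgraph_iff rational_rel_def subset_iff)
    moreover have "x \<in> P (pfun \<phi> x - x)" using x by (auto simp: P_def ext0_def)
    ultimately show "x \<in> (\<Union>q\<in>\<rat>. P q)" by blast
  qed (auto simp: P_def ext0_def)
  have im: "C = (\<Union>q\<in>\<rat>. Q q)"
  proof (intro set_eqI iffI)
    fix y assume "y \<in> C"
    then obtain x where x: "x \<in> pdom \<phi>" "y = pfun \<phi> x" using C bij by (auto simp: bij_betw_def)
    then have "x \<in> pfun \<phi> -` C \<inter> pdom \<phi>" using \<open>y \<in> C\<close> by simp
    then obtain q where "q \<in> \<rat>" "x \<in> P q" using pre by blast
    then have "y \<in> Q q" using x by (auto simp: P_def Q_def ext0_def)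
    with \<open>q \<in> \<rat>\<close> show "y \<in> (\<Union>q\<in>\<rat>. Q q)" by blast
  qed (auto simp: P_def Q_def)
  have disjP: "disjoint_family_on P \<rat>" by (auto simp: disjoint_family_on_def P_def)
  have disjQ: "disjoint_family_on Q \<rat>"
    unfolding disjoint_family_on_def
  proof (intro ballI impI)
    fix p q :: real assume "p \<noteq> q"
    have False if "y \<in> Q p" "y \<in> Q q" for y
    proof -
      have "pfun \<phi> (- p + y) = y" "pfun \<phi> (- q + y) = y" "- p + y \<in> pdom \<phi>" "- q + y \<in> pdom \<phi>"
        using that by (auto simp: Q_def P_def ext0_def)
      then have "- p + y = - q + y" using inj by (metis inj_onD)
      with \<open>p \<noteq> q\<close> show False by simp
    qed
    then show "Q p \<inter> Q q = {}" by blast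
  qed
  have eq: "emeasure lborel (P q) = emeasure lborel (Q q)" for q
    unfolding Q_def by (subst (1) lborel_distr_plus[of "- q", symmetric], subst emeasure_distr) auto
  have sub: "pfun \<phi> -` C \<inter> pdom \<phi> \<subseteq> {0..1}" using D01 by auto
  have "emeasure mu01 (pfun \<phi> -` C \<inter> pdom \<phi>) = emeasure lborel (\<Union>q\<in>\<rat>. P q)"
    using emeasure_mu01[OF sub] by (simp only: pre)
  also have "\<dots> = (\<integral>\<^sup>+q. emeasure lborel (P q) \<partial>count_space \<rat>)"
    using P disjP by (intro emeasure_UN_countable) (auto intro: countable_rat)
  also have "\<dots> = (\<integral>\<^sup>+q. emeasure lborel (Q q) \<partial>count_space \<rat>)" by (simp add: eq)
  also have "\<dots> = emeasure lborel (\<Union>q\<in>\<rat>. Q q)"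
    using Qm disjQ by (intro emeasure_UN_countable[symmetric]) (auto intro: countable_rat)
  also have "\<dots> = emeasure mu01 C"
    using emeasure_mu01[OF C01] by (simp only: im[symmetric])
  finally show "emeasure mu01 (pfun \<phi> -` C \<inter> pdom \<phi>) = emeasure mu01 C" .
qed

lemma countable_mp_rational_rel: "countable_mp_equiv_rel mu01 rational_rel"
  unfolding countable_mp_equiv_rel_def
proof (intro conjI ballI)
  show "equiv (space mu01) rational_rel" using equiv_rational_rel by simp
  have id: "(\<lambda>x. x) \<in> borel_measurable mu01"
    unfolding mu01_def by (rule measurable_restrict_space1) simp
  have fst: "fst \<in> borel_measurable (mu01 \<Otimes>\<^sub>M mu01)" and snd: "snd \<in> borel_measurable (mu01 \<Otimes>\<^sub>M mu01)"
    by (rule measurable_compose[OF measurable_fst id]) (rule measurable_compose[OF measurable_snd id])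
  have "(\<lambda>p. snd p - fst p) \<in> borel_measurable (mu01 \<Otimes>\<^sub>M mu01)"
    using snd fst by (rule borel_measurable_diff)
  then have "(\<lambda>p. snd p - fst p) -` \<rat> \<inter> space (mu01 \<Otimes>\<^sub>M mu01) \<in> sets (mu01 \<Otimes>\<^sub>M mu01)"
    using Rats_in_borel by (rule measurable_sets)
  also have "(\<lambda>p. snd p - fst p) -` \<rat> \<inter> space (mu01 \<Otimes>\<^sub>M mu01) = rational_rel"
    by (auto simp: rational_rel_def space_pair_measure)
  finally show "rational_rel \<in> sets (mu01 \<Otimes>\<^sub>M mu01)" .
  show "countable (rational_rel `` {x})" for x
  proof (rule countable_subset)
    show "rational_rel `` {x} \<subseteq> (\<lambda>q. x + q) ` \<rat>"
      by (auto simp: rational_rel_def image_iff intro!: bexI[of _ "_ - x"])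
  qed (intro countable_image countable_rat)
qed (rule rational_rel_preserves_measure)

lemma pgraph_subset_rational_rel: "pgraph (ex_family i) \<subseteq> rational_rel"
proof -
  \<comment> \<open>With \<open>UNIV\<close> as relation the graph condition is void; only the
    bounds on domain and codomain are wanted.\<close>
  have "ex_family i \<in> full_pseudogroup mu01 UNIV" by (intro ex_family_in_full_pseudogroup) simp
  then have sub: "pdom (ex_family i) \<subseteq> {0..1}" "pcod (ex_family i) \<subseteq> {0..1}"
    and img: "pfun (ex_family i) ` pdom (ex_family i) = pcod (ex_family i)"
    by (auto simp: full_pseudogroup_mu01_iff bij_betw_def)
  have "pfun (ex_family i) x - x \<in> \<rat>" for x
    by (cases i) (auto simp: phi1_def phi2_def psi1_def psi2_def)
  with sub img show ?thesis
    unfolding pgraph_def rational_rel_def by blast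
qed

text \<open>Needed because the existence claim asks for an index set of natural numbers, while the
  example is indexed by \<open>ex_index\<close>.\<close>

lemma DSE_reindex:
  fixes M :: "'a measure" and \<Phi> :: "'j \<Rightarrow> 'a pmap"
  assumes "bij_betw h I J"
  shows "DSE M E n I (\<lambda>i. \<Phi> (h i)) \<longleftrightarrow> DSE M E n J \<Phi>"
proof -
  have "(\<Sum>\<^sub>\<infinity>i\<in>I. indicator (S (\<Phi> (h i))) x :: ennreal) = (\<Sum>\<^sub>\<infinity>j\<in>J. indicator (S (\<Phi> j)) x)"
    for S :: "'a pmap \<Rightarrow> 'a set" and x
    by (rule infsum_reindex_bij_betw[OF assms])
  moreover have "countable I \<longleftrightarrow> countable J"
    using assms by (metis bij_betw_def countable_image_inj_eq)
  moreover have "(\<forall>i\<in>I. \<Phi> (h i) \<in> full_pseudogroup M E) \<longleftrightarrow> (\<forall>j\<in>J. \<Phi> j \<in> full_pseudogroup M E)"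
    using assms by (auto simp: bij_betw_def)
  ultimately show ?thesis by (simp add: DSE_def)
qed

lemma decomposable_reindex:
  assumes "bij_betw h I J"
  shows "decomposable M E n I (\<lambda>i. \<Phi> (h i)) \<longleftrightarrow> decomposable M E n J \<Phi>"
proof -
  have "dse_matrix I (\<lambda>i. \<Phi> (h i)) = dse_matrix J \<Phi>"
    unfolding dse_matrix_def by (rule ext) (rule infsum_reindex_bij_betw[OF assms])
  then show ?thesis by (simp add: decomposable_def)
qed

theorem mainTheorem2:
  shows "(\<forall>E. countable_mp_equiv_rel mu01 E \<and> (\<forall>i. pgraph (ex_family i) \<subseteq> E) \<longrightarrow>
            DSE mu01 E 2 UNIV ex_family \<and>
            \<not> decomposable mu01 E 2 UNIV ex_family \<and>
            (\<forall>\<psi>\<in>{psi1, psi2}. \<exists>g. glues_onto mu01 E \<psi> {0<..<1/2} g))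
       \<and> (\<exists>E (I :: nat set) (\<Phi> :: nat \<Rightarrow> real pmap).
            countable_mp_equiv_rel mu01 E \<and> DSE mu01 E 2 I \<Phi> \<and> \<not> decomposable mu01 E 2 I \<Phi>)"
proof -
  have main: "DSE mu01 E 2 UNIV ex_family \<and> \<not> decomposable mu01 E 2 UNIV ex_family \<and>
      (\<forall>\<psi>\<in>{psi1, psi2}. \<exists>g. glues_onto mu01 E \<psi> {0<..<1/2} g)"
    if E: "countable_mp_equiv_rel mu01 E" and graph: "\<And>i. pgraph (ex_family i) \<subseteq> E" for E
  proof -
    have "E \<subseteq> {0..1} \<times> {0..1}"
      using E by (auto simp: countable_mp_equiv_rel_def equiv_def refl_on_def)
    with graph show ?thesis
      using ex_family_DSE ex_family_not_decomposable psi_glue by blast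
  qed
  have "\<exists>E (I :: nat set) (\<Phi> :: nat \<Rightarrow> real pmap).
            countable_mp_equiv_rel mu01 E \<and> DSE mu01 E 2 I \<Phi> \<and> \<not> decomposable mu01 E 2 I \<Phi>"
  proof (intro exI conjI)
    let ?I = "to_nat_on (UNIV :: ex_index set) ` UNIV"
    have bij: "bij_betw (from_nat_into (UNIV :: ex_index set)) ?I UNIV"
      using inj_on_to_nat_on[OF countable_ex_index] countable_ex_index
      by (intro bij_betwI[where g = "to_nat_on UNIV"]) auto
    note main' = main[OF countable_mp_rational_rel pgraph_subset_rational_rel]
    show "countable_mp_equiv_rel mu01 rational_rel" by (rule countable_mp_rational_rel)
    show "DSE mu01 rational_rel 2 ?I (\<lambda>k. ex_family (from_nat_into UNIV k))"
      unfolding DSE_reindex[OF bij] using main' by blast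
    show "\<not> decomposable mu01 rational_rel 2 ?I (\<lambda>k. ex_family (from_nat_into UNIV k))"
      unfolding decomposable_reindex[OF bij] using main' by blast
  qed
  with main show ?thesis by blast
qed

end
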